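(* Let $R$ be an integral domain containing $\mathbb{Q}$. If $(E(t),H(t),P(t))$ is a symmetric triple over $R$, then so are \begin{align*} &(H(t),\ E(t),\ P(-t)),\\ &(E(t)^\alpha,\ H(t)^\alpha,\ \alpha P(t)) \qquad \text{for } \alpha \text{ any constant},\\ &(E(-\phi(-t)),\ H(\phi(t)),\ \phi'(t) P(\phi(t))) \qquad \text{for } \phi(t) \text{ any power series with } \phi(0)=0. \end{align*} Moreover, two symmetric triples $(E_1,H_1,P_1)$ and $(E_2,H_2,P_2)$ may be combined to get a third symmetric triple: $$(E_1 \cdot E_2,\ H_1 \cdot H_2,\ P_1+P_2).$$
   Context: All power series are formal power series with coefficients in an integral domain $R$ containing $\mathbb{Q}$, and constants and coefficients of $\phi$ lie in $R$. A symmetric triple is a triple $(E(t),H(t),P(t))$ of formal power series such that $E(t)$ and $H(t)$ have constant term $1$ and $$P(-t)=\frac{d}{dt}\log E(t),\qquad P(t)=\frac{d}{dt}\log H(t),$$ i.e. $P(-t)=E'(t)/E(t)$ and $P(t)=H'(t)/H(t)$. For a power series $1+f(t)$ with $f(0)=0$ and a constant $\alpha$, $(1+f(t))^\alpha := \sum_{k\ge 0}\binom{\alpha}{k} f(t)^k$, where $\binom{\alpha}{0}=1$ and $\binom{\alpha}{k}=\alpha(\alpha-1)\cdots(\alpha-k+1)/k!$ for $k\ge 1$. *)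

theory Defs
  imports "HOL-Computational_Algebra.Formal_Power_Series"
begin

text \<open>
  ``\<open>R\<close> contains \<open>\<rat>\<close>'' is rendered by an embedding \<open>\<iota>\<close> of the field of rationals as a subring.
  There is no division on a general integral domain, so the rational numbers occurring in the
  series below are written as \<open>\<iota> q\<close>.  (Such an \<open>\<iota>\<close> is unique if it exists.)
\<close>

definition rat_embedding :: "(rat \<Rightarrow> 'a::idom) \<Rightarrow> bool" where
  "rat_embedding \<iota> \<longleftrightarrow>
     inj \<iota> \<and> \<iota> 1 = 1 \<and> (\<forall>x y. \<iota> (x + y) = \<iota> x + \<iota> y) \<and> (\<forall>x y. \<iota> (x * y) = \<iota> x * \<iota> y)"

text \<open>
  The library's \<open>gchoose\<close> and \<open>fps_ln\<close> presuppose a division operation on the coefficients;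
  the following three definitions are their analogues over \<open>R\<close>.
\<close>

definition binom :: "(rat \<Rightarrow> 'a::idom) \<Rightarrow> 'a \<Rightarrow> nat \<Rightarrow> 'a" where
  "binom \<iota> \<alpha> k = \<iota> (1 / fact k) * (\<Prod>i<k. \<alpha> - of_nat i)"

text \<open>
  \<open>F\<^sup>\<alpha> = (\<Sum>k. binom \<alpha> k * (F - 1)\<^sup>k)\<close> and
  \<open>log F = (\<Sum>k\<ge>1. (-1)\<^sup>k\<^sup>-\<^sup>1 / k * (F - 1)\<^sup>k)\<close>, meaningful when \<open>F\<close> has constant term 1;
  \<open>oo\<close> is composition of formal power series.
\<close>

definition fps_gpow :: "(rat \<Rightarrow> 'a::idom) \<Rightarrow> 'a fps \<Rightarrow> 'a \<Rightarrow> 'a fps" where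
  "fps_gpow \<iota> F \<alpha> = Abs_fps (binom \<iota> \<alpha>) oo (F - 1)"

definition fps_log :: "(rat \<Rightarrow> 'a::idom) \<Rightarrow> 'a fps \<Rightarrow> 'a fps" where
  "fps_log \<iota> F = Abs_fps (\<lambda>k. if k = 0 then 0 else \<iota> ((- 1) ^ (k - 1) / of_nat k)) oo (F - 1)"

text \<open>\<open>fps_neg_arg F\<close> is \<open>F(-t)\<close>.\<close>

definition fps_neg_arg :: "'a::idom fps \<Rightarrow> 'a fps" where
  "fps_neg_arg F = F oo (- fps_X)"

definition symmetric_triple :: "(rat \<Rightarrow> 'a::idom) \<Rightarrow> 'a fps \<Rightarrow> 'a fps \<Rightarrow> 'a fps \<Rightarrow> bool" where
  "symmetric_triple \<iota> E H P \<longleftrightarrow>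
     fps_nth E 0 = 1 \<and> fps_nth H 0 = 1 \<and>
     fps_neg_arg P = fps_deriv (fps_log \<iota> E) \<and> P = fps_deriv (fps_log \<iota> H)"

text \<open>The expected identity \<open>(log F)' = F' / F\<close>; recall that \<open>F\<close> is a unit.\<close>

lemma fps_deriv_log:
  assumes "rat_embedding \<iota>" and F0: "fps_nth F 0 = 1"
  shows "fps_deriv (fps_log \<iota> F) * F = fps_deriv F"
proof -
  define L where "L = Abs_fps (\<lambda>k. if k = 0 then 0 else \<iota> ((- 1) ^ (k - 1) / of_nat k))"
  from assms have i1: "\<iota> 1 = 1" and ia: "\<And>x y. \<iota> (x + y) = \<iota> x + \<iota> y"
    and im: "\<And>x y. \<iota> (x * y) = \<iota> x * \<iota> y"
    by (auto simp: rat_embedding_def)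
  have i0: "\<iota> 0 = 0" using ia[of 0 0] by (metis add_0_right add_left_cancel)
  have ineg: "\<iota> (- x) = - \<iota> x" for x using ia[of x "- x"] i0 by (simp add: eq_neg_iff_add_eq_0 add.commute)
  have inat: "\<iota> (of_nat n) = of_nat n" for n by (induction n) (simp_all add: i0 i1 ia)
  have L': "fps_nth (fps_deriv L) n = (- 1) ^ n" for n
  proof -
    have "fps_nth (fps_deriv L) n = \<iota> (of_nat (Suc n)) * \<iota> ((- 1) ^ n / of_nat (Suc n))"
      by (simp only: inat) (simp add: L_def)
    also have "\<dots> = \<iota> ((- 1) ^ n)" by (simp only: im[symmetric]) simp
    also have "\<dots> = (- 1) ^ n" by (induction n) (simp_all add: i1 ineg)
    finally show ?thesis .
  qed
  have "fps_deriv L * (1 + fps_X) = 1"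
  proof (rule fps_ext)
    fix n
    show "fps_nth (fps_deriv L * (1 + fps_X)) n = fps_nth 1 n"
      by (cases n) (simp_all add: distrib_left L' del: fps_deriv_nth)
  qed
  moreover have c0: "fps_nth (F - 1) 0 = 0" using F0 by simp
  ultimately have "(fps_deriv L oo (F - 1)) * F = 1"
    using fps_compose_mult_distrib[OF c0, of "fps_deriv L" "1 + fps_X"]
    by (simp add: fps_compose_add_distrib c0)
  moreover have "fps_deriv (fps_log \<iota> F) = (fps_deriv L oo (F - 1)) * fps_deriv F"
    unfolding fps_log_def L_def[symmetric] by (simp only: fps_compose_deriv[OF c0]) simp
  ultimately show ?thesis by (simp add: mult_ac)
qed

lemma symmetric_triple_iff:
  assumes "rat_embedding \<iota>"
  shows "symmetric_triple \<iota> E H P \<longleftrightarrow>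
     fps_nth E 0 = 1 \<and> fps_nth H 0 = 1 \<and>
     fps_neg_arg P * E = fps_deriv E \<and> P * H = fps_deriv H"
proof -
  have "A = fps_deriv (fps_log \<iota> F) \<longleftrightarrow> A * F = fps_deriv F" if "fps_nth F 0 = 1" for A F
  proof -
    have "F \<noteq> 0" using that by auto
    then show ?thesis using fps_deriv_log[OF assms that] by (metis mult_right_cancel)
  qed
  then show ?thesis unfolding symmetric_triple_def by blast
qed

end

theory Submission
  imports Defs
begin

text \<open>
  Since the constant terms are 1, being a symmetric triple means that the two differential
  equations \<open>A * F = F'\<close> hold, with \<open>(A, F) = (P(-t), E)\<close> and \<open>(A, F) = (P, H)\<close>; these equations
  involve no logarithms and no division.  The set of such pairs \<open>(A, F)\<close> is closed
  under three operations, one for each property of logarithmic derivatives: products of the \<open>F\<close>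
  add the \<open>A\<close> (Leibniz rule), the power \<open>F\<^sup>\<alpha>\<close> scales \<open>A\<close> by \<open>\<alpha>\<close>, and a substitution \<open>\<phi>\<close> sends
  \<open>A\<close> to \<open>\<phi>' * (A oo \<phi>)\<close> (chain rule).

  Exchanging \<open>E\<close> and \<open>H\<close> exchanges the two equations, because \<open>P \<mapsto> P(-t)\<close> is an involution.
  In each of the other claims the equation for \<open>H\<close> is one of the closure properties, and the one
  for \<open>E\<close> is the same property applied to \<open>P(-t)\<close>, because \<open>P \<mapsto> P(-t)\<close> is a ring homomorphism.
  For the substitution, \<open>E\<close> requires \<open>\<psi>(t) = -\<phi>(-t)\<close> rather than \<open>\<phi>\<close>: its derivative is
  \<open>\<phi>'(-t)\<close>, and \<open>t \<mapsto> -t\<close> after \<open>\<psi>\<close> is \<open>\<phi>(-t)\<close>, so that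
  \<open>\<psi>'(t) P(-\<psi>(t)) = \<phi>'(-t) P(\<phi>(-t))\<close>, which is \<open>\<phi>' * (P oo \<phi>)\<close> evaluated at \<open>-t\<close>.
\<close>

lemma fps_neg_arg_nth_0 [simp]: "fps_nth (fps_neg_arg F) 0 = fps_nth F 0"
  by (simp add: fps_neg_arg_def)

lemma fps_neg_arg_mult: "fps_neg_arg (F * G) = fps_neg_arg F * fps_neg_arg G"
  by (simp add: fps_neg_arg_def fps_compose_mult_distrib)

lemma fps_neg_arg_add: "fps_neg_arg (F + G) = fps_neg_arg F + fps_neg_arg G"
  by (simp add: fps_neg_arg_def fps_compose_add_distrib)

lemma fps_neg_arg_const [simp]: "fps_neg_arg (fps_const c) = fps_const c"
  by (simp add: fps_neg_arg_def)

lemma fps_neg_arg_compose: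
  assumes "fps_nth \<psi> 0 = 0"
  shows "fps_neg_arg F oo \<psi> = F oo (- \<psi>)"
proof -
  have "fps_neg_arg F oo \<psi> = F oo ((- fps_X) oo \<psi>)"
    unfolding fps_neg_arg_def by (rule fps_compose_assoc[symmetric]) (simp_all add: assms)
  then show ?thesis using assms by (simp add: fps_compose_uminus)
qed

lemma compose_fps_neg_arg:
  assumes "fps_nth \<phi> 0 = 0"
  shows "F oo fps_neg_arg \<phi> = fps_neg_arg (F oo \<phi>)"
  unfolding fps_neg_arg_def by (rule fps_compose_assoc) (simp_all add: assms)

lemma fps_neg_arg_involution [simp]: "fps_neg_arg (fps_neg_arg F) = F"
  using fps_neg_arg_compose[of "- fps_X" F] by (simp add: fps_neg_arg_def)

lemma fps_deriv_neg_arg: "fps_deriv (fps_neg_arg F) = - fps_neg_arg (fps_deriv F)"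
  by (simp add: fps_neg_arg_def fps_compose_deriv)

lemma log_deriv_mult:
  fixes A B F G :: "'a::idom fps"
  assumes "A * F = fps_deriv F" and "B * G = fps_deriv G"
  shows "(A + B) * (F * G) = fps_deriv (F * G)"
  by (simp add: assms[symmetric] algebra_simps)

lemma log_deriv_compose:
  fixes A F \<phi> :: "'a::idom fps"
  assumes "A * F = fps_deriv F" and "fps_nth \<phi> 0 = 0"
  shows "(fps_deriv \<phi> * (A oo \<phi>)) * (F oo \<phi>) = fps_deriv (F oo \<phi>)"
proof -
  have "fps_deriv (F oo \<phi>) = ((A * F) oo \<phi>) * fps_deriv \<phi>"
    using assms by (simp add: fps_compose_deriv)
  then show ?thesis using assms(2) by (simp add: fps_compose_mult_distrib mult_ac)
qed

text \<open>
  Division by factorials takes place in the rationals, so the factor \<open>k + 1\<close> is moved inside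
  \<open>\<iota>\<close>, where it turns \<open>1 / (k + 1)!\<close> into \<open>1 / k!\<close>.
\<close>

lemma binom_Suc:
  assumes "rat_embedding \<iota>"
  shows "of_nat (Suc k) * binom \<iota> \<alpha> (Suc k) = (\<alpha> - of_nat k) * binom \<iota> \<alpha> k"
proof -
  from assms have i1: "\<iota> 1 = 1" and ia: "\<And>x y. \<iota> (x + y) = \<iota> x + \<iota> y"
    and im: "\<And>x y. \<iota> (x * y) = \<iota> x * \<iota> y"
    by (auto simp: rat_embedding_def)
  have i0: "\<iota> 0 = 0" using ia[of 0 0] by (metis add_0_right add_left_cancel)
  have inat: "\<iota> (of_nat n) = of_nat n" for n
    by (induction n) (simp_all add: i0 i1 ia)
  have "of_nat (Suc k) * \<iota> (1 / fact (Suc k)) = \<iota> (of_nat (Suc k) * (1 / fact (Suc k)))"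
    by (simp only: im inat)
  also have "of_nat (Suc k) * (1 / fact (Suc k)) = (1 / fact k :: rat)"
    by (simp add: fact_Suc del: of_nat_Suc)
  finally have *: "of_nat (Suc k) * \<iota> (1 / fact (Suc k)) = \<iota> (1 / fact k)" .
  have "of_nat (Suc k) * binom \<iota> \<alpha> (Suc k)
      = (of_nat (Suc k) * \<iota> (1 / fact (Suc k))) * (\<Prod>i<Suc k. \<alpha> - of_nat i)"
    unfolding binom_def by (simp only: mult.assoc)
  then show ?thesis by (simp only: *) (simp add: binom_def mult_ac)
qed

text \<open>
  The two terms of \<open>1 + t\<close> each contribute to the coefficient of \<open>t\<^sup>n\<close>: by the recurrence above they give
  \<open>\<alpha> - n\<close> and \<open>n\<close> times the binomial coefficient, hence \<open>\<alpha>\<close> times it.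
\<close>

lemma binomial_series_ode:
  assumes "rat_embedding \<iota>"
  shows "fps_deriv (Abs_fps (binom \<iota> \<alpha>)) * (1 + fps_X) = fps_const \<alpha> * Abs_fps (binom \<iota> \<alpha>)"
proof (rule fps_ext)
  fix n
  have d: "fps_nth (fps_deriv (Abs_fps (binom \<iota> \<alpha>))) m = (\<alpha> - of_nat m) * binom \<iota> \<alpha> m" for m
    using binom_Suc[OF assms, of m \<alpha>] by simp
  show "fps_nth (fps_deriv (Abs_fps (binom \<iota> \<alpha>)) * (1 + fps_X)) n
      = fps_nth (fps_const \<alpha> * Abs_fps (binom \<iota> \<alpha>)) n"
  proof (cases n)
    case 0
    then show ?thesis by (simp add: distrib_left d del: fps_deriv_nth)
  next
    case (Suc m)
    have "fps_nth (fps_deriv (Abs_fps (binom \<iota> \<alpha>)) * (1 + fps_X)) n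
        = (\<alpha> - of_nat n) * binom \<iota> \<alpha> n + (\<alpha> - of_nat m) * binom \<iota> \<alpha> m"
      using Suc by (simp add: distrib_left d del: fps_deriv_nth of_nat_Suc)
    also have "(\<alpha> - of_nat m) * binom \<iota> \<alpha> m = of_nat n * binom \<iota> \<alpha> n"
      using binom_Suc[OF assms, of m \<alpha>] Suc by simp
    finally show ?thesis by (simp add: algebra_simps)
  qed
qed

lemma fps_gpow_nth_0:
  assumes "rat_embedding \<iota>"
  shows "fps_nth (fps_gpow \<iota> F \<alpha>) 0 = 1"
  using assms by (simp add: fps_gpow_def binom_def rat_embedding_def)

text \<open>
  Substituting \<open>F - 1\<close> for \<open>t\<close> in the equation of the binomial series gives
  \<open>(F\<^sup>\<alpha>)' * F = \<alpha> * F\<^sup>\<alpha> * F'\<close>, and \<open>F' = A * F\<close>; the factor \<open>F\<close> can be cancelled, as power series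
  over a domain form a domain.
\<close>

lemma log_deriv_gpow:
  assumes \<iota>: "rat_embedding \<iota>" and F0: "fps_nth F 0 = 1" and A: "A * F = fps_deriv F"
  shows "(fps_const \<alpha> * A) * fps_gpow \<iota> F \<alpha> = fps_deriv (fps_gpow \<iota> F \<alpha>)"
proof -
  define B where "B = Abs_fps (binom \<iota> \<alpha>)"
  have c0: "fps_nth (F - 1) 0 = 0" using F0 by simp
  have G: "fps_gpow \<iota> F \<alpha> = B oo (F - 1)" by (simp add: fps_gpow_def B_def)
  have "(fps_deriv B * (1 + fps_X)) oo (F - 1) = (fps_const \<alpha> * B) oo (F - 1)"
    using binomial_series_ode[OF \<iota>] by (simp add: B_def)
  then have ode: "(fps_deriv B oo (F - 1)) * F = fps_const \<alpha> * (B oo (F - 1))"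
    by (simp add: fps_compose_mult_distrib[OF c0] fps_compose_add_distrib
        fps_X_fps_compose_startby0[OF c0])
  have "fps_deriv (B oo (F - 1)) * F = ((fps_deriv B oo (F - 1)) * F) * fps_deriv F"
    by (simp only: fps_compose_deriv[OF c0]) (simp add: mult_ac)
  also have "\<dots> = ((fps_const \<alpha> * A) * (B oo (F - 1))) * F"
    by (simp only: ode A[symmetric]) (simp only: mult_ac)
  finally have "fps_deriv (B oo (F - 1)) * F = ((fps_const \<alpha> * A) * (B oo (F - 1))) * F" .
  moreover have "F \<noteq> 0" using F0 by auto
  ultimately show ?thesis unfolding G by (metis mult_right_cancel)
qed

lemma symmetric_triple_swap:
  assumes "rat_embedding \<iota>" and "symmetric_triple \<iota> E H P"
  shows "symmetric_triple \<iota> H E (fps_neg_arg P)"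
  using assms(2) by (simp add: symmetric_triple_iff[OF assms(1)])

lemma symmetric_triple_gpow:
  assumes \<iota>: "rat_embedding \<iota>" and "symmetric_triple \<iota> E H P"
  shows "symmetric_triple \<iota> (fps_gpow \<iota> E \<alpha>) (fps_gpow \<iota> H \<alpha>) (fps_const \<alpha> * P)"
  using assms(2) unfolding symmetric_triple_iff[OF \<iota>]
  by (simp add: fps_gpow_nth_0[OF \<iota>] fps_neg_arg_mult log_deriv_gpow[OF \<iota>])

lemma symmetric_triple_compose:
  assumes \<iota>: "rat_embedding \<iota>" and T: "symmetric_triple \<iota> E H P" and \<phi>: "fps_nth \<phi> 0 = 0"
  shows "symmetric_triple \<iota> (E oo (- fps_neg_arg \<phi>)) (H oo \<phi>) (fps_deriv \<phi> * (P oo \<phi>))"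
proof -
  define \<psi> where "\<psi> = - fps_neg_arg \<phi>"
  have \<psi>0: "fps_nth \<psi> 0 = 0" using \<phi> by (simp add: \<psi>_def)
  have E: "fps_nth E 0 = 1" "fps_neg_arg P * E = fps_deriv E"
    and H: "fps_nth H 0 = 1" "P * H = fps_deriv H"
    using T by (auto simp: symmetric_triple_iff[OF \<iota>])
  have "fps_deriv \<psi> = fps_neg_arg (fps_deriv \<phi>)"
    by (simp only: \<psi>_def fps_deriv_neg fps_deriv_neg_arg minus_minus)
  moreover have "fps_neg_arg P oo \<psi> = fps_neg_arg (P oo \<phi>)"
    using fps_neg_arg_compose[OF \<psi>0, of P] compose_fps_neg_arg[OF \<phi>, of P] by (simp add: \<psi>_def)
  ultimately have "fps_neg_arg (fps_deriv \<phi> * (P oo \<phi>)) = fps_deriv \<psi> * (fps_neg_arg P oo \<psi>)"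
    by (simp add: fps_neg_arg_mult)
  then show ?thesis
    using log_deriv_compose[OF E(2) \<psi>0] log_deriv_compose[OF H(2) \<phi>] E(1) H(1)
    by (simp add: symmetric_triple_iff[OF \<iota>] \<psi>_def[symmetric])
qed

lemma symmetric_triple_mult:
  assumes \<iota>: "rat_embedding \<iota>"
    and "symmetric_triple \<iota> E1 H1 P1" and "symmetric_triple \<iota> E2 H2 P2"
  shows "symmetric_triple \<iota> (E1 * E2) (H1 * H2) (P1 + P2)"
  using assms(2,3) unfolding symmetric_triple_iff[OF \<iota>] fps_neg_arg_add
  by (simp add: log_deriv_mult del: fps_deriv_mult)

theorem proposition4p2:
  fixes \<iota> :: "rat \<Rightarrow> 'a::idom"
  assumes "rat_embedding \<iota>"
  shows "(\<forall>E H P. symmetric_triple \<iota> E H P \<longrightarrow>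
            symmetric_triple \<iota> H E (fps_neg_arg P) \<and>
            (\<forall>\<alpha>. symmetric_triple \<iota> (fps_gpow \<iota> E \<alpha>) (fps_gpow \<iota> H \<alpha>) (fps_const \<alpha> * P)) \<and>
            (\<forall>\<phi>. fps_nth \<phi> 0 = 0 \<longrightarrow>
               symmetric_triple \<iota> (E oo (- fps_neg_arg \<phi>)) (H oo \<phi>) (fps_deriv \<phi> * (P oo \<phi>)))) \<and>
         (\<forall>E1 H1 P1 E2 H2 P2. symmetric_triple \<iota> E1 H1 P1 \<and> symmetric_triple \<iota> E2 H2 P2 \<longrightarrow>
            symmetric_triple \<iota> (E1 * E2) (H1 * H2) (P1 + P2))"
  using symmetric_triple_swap[OF assms] symmetric_triple_gpow[OF assms]
    symmetric_triple_compose[OF assms] symmetric_triple_mult[OF assms]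
  by blast

end
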